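(* Let $X$ and $Y$ be finite ultrametric spaces with $|X|=|Y|$. If $Y\in\mathfrak{R}$, then $|\operatorname{Sp}(X)|\le|\operatorname{Sp}(Y)|$.
   Context: An ultrametric space is a metric space with $d(x,y)\le\max\{d(x,z),d(z,y)\}$ for all $x,y,z$. The spectrum of a metric space $(X,d)$ is $\operatorname{Sp}(X)=\{d(x,y):x,y\in X\}$. $\operatorname{Iso}(X)$ is the group of isometries of $(X,d)$ (bijective distance-preserving maps $X\to X$), and $\operatorname{Fix}(g)=\{x\in X: g(x)=x\}$. $\mathfrak{R}$ denotes the class of all finite ultrametric spaces $(X,d)$ with $\min_{g\in \operatorname{Iso}(X)}|\operatorname{Fix}(g)|=|X|-2$. *)

theory Defs
  imports "HOL-Analysis.Abstract_Metric_Spaces" "HOL-Algebra.Bij"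
begin

locale Ultrametric_space = Metric_space +
  assumes ultrametric: "\<lbrakk>x \<in> M; y \<in> M; z \<in> M\<rbrakk> \<Longrightarrow> d x y \<le> max (d x z) (d z y)"

definition spectrum :: "'a set \<Rightarrow> ('a \<Rightarrow> 'a \<Rightarrow> real) \<Rightarrow> real set" where
  "spectrum X d = {d x y | x y. x \<in> X \<and> y \<in> X}"

(* As in Bij, maps are extensional, so that each isometry of the carrier
   is represented by exactly one HOL function. *)
definition isometries :: "'a set \<Rightarrow> ('a \<Rightarrow> 'a \<Rightarrow> real) \<Rightarrow> ('a \<Rightarrow> 'a) set" where
  "isometries X d = {g \<in> Bij X. \<forall>x\<in>X. \<forall>y\<in>X. d (g x) (g y) = d x y}"

definition fixed_points :: "'a set \<Rightarrow> ('a \<Rightarrow> 'a) \<Rightarrow> 'a set" where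
  "fixed_points X g = {x \<in> X. g x = x}"

(* The subtraction is taken in the integers: truncated subtraction on nat
   would put the empty space into the class. *)
definition in_class_R :: "'a set \<Rightarrow> ('a \<Rightarrow> 'a \<Rightarrow> real) \<Rightarrow> bool" where
  "in_class_R X d \<longleftrightarrow> finite X \<and> Ultrametric_space X d \<and>
     int (Min ((\<lambda>g. card (fixed_points X g)) ` isometries X d)) = int (card X) - 2"

lemma id_in_isometries: "(\<lambda>x\<in>X. x) \<in> isometries X d"
  by (simp add: isometries_def id_Bij)

lemma finite_fixed_point_counts:
  assumes "finite X"
  shows "finite ((\<lambda>g. card (fixed_points X g)) ` isometries X d)"
proof (rule finite_subset)
  show "(\<lambda>g. card (fixed_points X g)) ` isometries X d \<subseteq> {..card X}"
    using assms by (auto simp: fixed_points_def intro!: card_mono)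
qed simp

lemma subgroup_isometries: "subgroup (isometries X d) (BijGroup X)"
proof (rule group.subgroupI[OF group_BijGroup])
  show "isometries X d \<subseteq> carrier (BijGroup X)"
    by (auto simp: isometries_def BijGroup_def)
  show "isometries X d \<noteq> {}"
    using id_in_isometries by blast
next
  fix g assume g: "g \<in> isometries X d"
  then have gB: "g \<in> Bij X"
    and d: "\<And>x y. x \<in> X \<Longrightarrow> y \<in> X \<Longrightarrow> d (g x) (g y) = d x y"
    by (auto simp: isometries_def)
  have "d (inv_into X g x) (inv_into X g y) = d x y" if "x \<in> X" "y \<in> X" for x y
  proof -
    have "g (inv_into X g x) = x" "g (inv_into X g y) = y"
      using that gB by (auto simp: Bij_def bij_betw_def f_inv_into_f)
    then show ?thesis
      using d[OF Bij_inv_into_mem[OF gB that(1)] Bij_inv_into_mem[OF gB that(2)]] by simp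
  qed
  then show "inv\<^bsub>BijGroup X\<^esub> g \<in> isometries X d"
    using gB by (simp add: isometries_def inv_BijGroup restrict_inv_into_Bij)
next
  fix g h assume gh: "g \<in> isometries X d" "h \<in> isometries X d"
  then have "h x \<in> X" if "x \<in> X" for x
    using that Bij_imp_funcset[of h X] by (auto simp: isometries_def)
  with gh show "g \<otimes>\<^bsub>BijGroup X\<^esub> h \<in> isometries X d"
    by (auto simp: isometries_def BijGroup_def compose_Bij compose_eq)
qed

end

theory Submission
  imports Defs "HOL-Combinatorics.Transposition"
begin

text \<open>
  Adding a point \<open>a\<close> to an ultrametric space contributes at most one new distance, namely the
  distance from \<open>a\<close> to a nearest neighbour \<open>b\<close>: any point farther from \<open>a\<close> is equidistant from
  \<open>a\<close> and \<open>b\<close>. Hence a finite ultrametric space has at most as many distances as points.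

  Conversely, let \<open>Y\<close> be in the class and let \<open>a\<close>, \<open>b\<close> be a closest pair of \<open>Y\<close>, so that swapping
  \<open>a\<close> and \<open>b\<close> is an isometry. If two points of \<open>Y\<close> had the same distance from \<open>a\<close>, a closest pair
  \<open>z\<close>, \<open>w\<close> of the sphere about \<open>a\<close> containing them could be swapped as well, and the product of
  the two swaps would move the three points \<open>a\<close>, \<open>z\<close>, \<open>w\<close>. So \<open>dist a\<close> is injective on \<open>Y\<close>,
  which gives as many distances as points.
\<close>

lemma card_fixed_points_le:
  assumes "finite X" "S \<subseteq> X" "\<And>x. x \<in> S \<Longrightarrow> g x \<noteq> x"
  shows "card (fixed_points X g) + card S \<le> card X"
proof -
  have "finite (fixed_points X g)" "finite S"
    using assms by (auto simp: fixed_points_def intro: finite_subset)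
  moreover have "fixed_points X g \<inter> S = {}" "fixed_points X g \<union> S \<subseteq> X"
    using assms by (auto simp: fixed_points_def)
  ultimately show ?thesis
    using assms(1) by (metis card_Un_disjoint card_mono)
qed

lemma in_class_R_le_card_fixed_points:
  assumes "in_class_R X d" "g \<in> isometries X d"
  shows "card X \<le> card (fixed_points X g) + 2"
proof -
  have "Min ((\<lambda>g. card (fixed_points X g)) ` isometries X d) \<le> card (fixed_points X g)"
    using assms by (intro Min_le finite_fixed_point_counts) (auto simp: in_class_R_def)
  then show ?thesis
    using assms(1) by (simp add: in_class_R_def)
qed

text \<open>The minimum is a natural number, so the integer equation leaves no room for
  \<open>card X - 2\<close> to be negative.\<close>

lemma in_class_R_card_ge_2: "in_class_R X d \<Longrightarrow> 2 \<le> card X"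
  by (simp add: in_class_R_def)

lemma finite_spectrum: "finite X \<Longrightarrow> finite (spectrum X d)"
  unfolding spectrum_def by (rule finite_image_set2) auto

lemma isometries_compose:
  assumes "g \<in> isometries X d" "h \<in> isometries X d"
  shows "compose X g h \<in> isometries X d"
proof -
  have "g \<in> Bij X" "h \<in> Bij X"
    using assms by (auto simp: isometries_def)
  then show ?thesis
    using subgroup.m_closed[OF subgroup_isometries assms] by (simp add: BijGroup_def)
qed

context Metric_space
begin

text \<open>Only distances between the pair and other points could change, and those agree by
  equidistance; \<open>d a b\<close> itself is kept by symmetry. The restriction to \<open>M\<close>
  makes the map extensional.\<close>

lemma transpose_in_isometries:
  assumes "a \<in> M" "b \<in> M" and "\<And>u. u \<in> M - {a, b} \<Longrightarrow> d u a = d u b"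
  shows "restrict (Transposition.transpose a b) M \<in> isometries M d"
proof -
  have "bij_betw (Transposition.transpose a b) M M"
    using assms(1,2) by (simp add: bij_betw_def)
  then have "restrict (Transposition.transpose a b) M \<in> Bij M"
    by (simp add: Bij_def)
  moreover have "d (Transposition.transpose a b x) (Transposition.transpose a b y) = d x y"
    if "x \<in> M" "y \<in> M" for x y
  proof -
    have r: "d u a = d u b" "d a u = d b u" if "u \<in> M" "u \<noteq> a" "u \<noteq> b" for u
      using assms(3)[of u] that by (simp_all add: commute)
    show ?thesis
    proof (cases "a = b")
      case False
      then show ?thesis
        using that assms(1,2) by (simp add: Transposition.transpose_def r commute[of b a])
    qed simp
  qed
  ultimately show ?thesis
    by (simp add: isometries_def)
qed

lemma obtain_closest_pair:
  assumes "finite S" "x \<in> S" "y \<in> S" "x \<noteq> y"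
  obtains z w where "z \<in> S" "w \<in> S" "z \<noteq> w"
    "\<And>u v. u \<in> S \<Longrightarrow> v \<in> S \<Longrightarrow> u \<noteq> v \<Longrightarrow> d z w \<le> d u v"
proof -
  define P where "P = {(u, v) \<in> S \<times> S. u \<noteq> v}"
  define p where "p = arg_min_on (case_prod d) P"
  have "finite P" "P \<noteq> {}"
    using assms by (auto simp: P_def intro: finite_subset[of _ "S \<times> S"])
  then have "p \<in> P" and least: "\<And>q. q \<in> P \<Longrightarrow> case_prod d p \<le> case_prod d q"
    unfolding p_def by (simp_all add: arg_min_if_finite(1) arg_min_least)
  then obtain z w where zw: "p = (z, w)" "z \<in> S" "w \<in> S" "z \<noteq> w"
    by (auto simp: P_def)
  show thesis
  proof (rule that[OF zw(2-4)])
    show "d z w \<le> d u v" if "u \<in> S" "v \<in> S" "u \<noteq> v" for u v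
      using least[of "(u, v)"] that by (simp add: P_def zw(1))
  qed
qed

end

context Ultrametric_space
begin

text \<open>The triangle inequality through \<open>x\<close> bounds \<open>d y z\<close> by
  \<open>d x z\<close>. In the one through \<open>y\<close>, the term \<open>d x y\<close> is too
  small to bound \<open>d x z\<close>, so \<open>d y z\<close> must.\<close>

lemma isosceles:
  assumes "x \<in> M" "y \<in> M" "z \<in> M" "d x y < d x z"
  shows "d y z = d x z"
  using ultrametric[of x z y] ultrametric[of y z x] assms commute[of x y] by linarith

text \<open>Stated for finite subsets \<open>F\<close> of \<open>M\<close> so that induction can add
  one point at a time.\<close>

lemma card_spectrum_le:
  assumes "finite F" "F \<subseteq> M"
  shows "card (spectrum F d) \<le> card F"
  using assms
proof (induction F rule: finite_induct)
  case empty
  then show ?case by (simp add: spectrum_def)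
next
  case (insert a F)
  show ?case
  proof (cases "F = {}")
    case True
    with insert.prems have "spectrum (insert a F) d = {0}"
      by (auto simp: spectrum_def)
    then show ?thesis using True by simp
  next
    case False
    define b where "b = arg_min_on (d a) F"
    have b: "b \<in> F" "\<And>z. z \<in> F \<Longrightarrow> d a b \<le> d a z"
      using False insert.hyps arg_min_if_finite[of F "d a"] arg_min_least[of F _ "d a"]
      by (auto simp: b_def)
    have sp: "d x y \<in> spectrum F d" if "x \<in> F" "y \<in> F" for x y
      using that by (auto simp: spectrum_def)
    have a: "d a z \<in> insert (d a b) (spectrum F d)" if "z \<in> F" for z
    proof (cases "d a z = d a b")
      case False
      then have "d b z = d a z"
        using b that insert.prems by (intro isosceles) (auto simp: less_le)
      then show ?thesis using sp[of b z] b that by simp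
    qed simp
    \<comment> \<open>The distance 0 is not new: it is already \<open>d b b\<close>.\<close>
    have "d a a \<in> spectrum F d"
      using sp[of b b] b insert.prems by auto
    have "spectrum (insert a F) d \<subseteq> insert (d a b) (spectrum F d)"
    proof -
      have "d z a \<in> insert (d a b) (spectrum F d)" if "z \<in> F" for z
        using a[OF that] by (simp only: commute)
      with a sp \<open>d a a \<in> spectrum F d\<close> show ?thesis
        unfolding spectrum_def[of "insert a F"] by blast
    qed
    then have "card (spectrum (insert a F) d) \<le> card (insert (d a b) (spectrum F d))"
      using insert.hyps by (intro card_mono) (auto simp: finite_spectrum)
    also have "\<dots> \<le> Suc (card (spectrum F d))"
      using insert.hyps by (simp add: finite_spectrum card_insert_if)
    also have "\<dots> \<le> card (insert a F)"
      using insert by simp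
    finally show ?thesis .
  qed
qed

text \<open>For \<open>u\<close> in \<open>S\<close> other than \<open>z\<close> and
  \<open>w\<close>, minimality makes \<open>d z w\<close> at most \<open>d u z\<close> and
  \<open>d u w\<close>, so the ultrametric inequality bounds each of these two by the other.\<close>

lemma closest_pair_swap:
  assumes "S \<subseteq> M" "z \<in> S" "w \<in> S"
    and "\<And>u v. u \<in> S \<Longrightarrow> v \<in> S \<Longrightarrow> u \<noteq> v \<Longrightarrow> d z w \<le> d u v"
    and "\<And>u. u \<in> M - S \<Longrightarrow> d u z = d u w"
  shows "restrict (Transposition.transpose z w) M \<in> isometries M d"
proof (rule transpose_in_isometries)
  show "z \<in> M" "w \<in> M" using assms by auto
  fix u assume u: "u \<in> M - {z, w}"
  show "d u z = d u w"
  proof (cases "u \<in> S")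
    case True
    then have "d z w \<le> d u z" "d z w \<le> d u w"
      using assms u by auto
    then show ?thesis
      using ultrametric[of u z w] ultrametric[of u w z] u \<open>z \<in> M\<close> \<open>w \<in> M\<close>
      by (simp add: commute max_def split: if_splits)
  qed (use assms u in auto)
qed

lemma in_class_R_card_le_spectrum:
  assumes R: "in_class_R M d"
  shows "card M \<le> card (spectrum M d)"
proof -
  have fin: "finite M" using R by (simp add: in_class_R_def)
  obtain x y where "x \<in> M" "y \<in> M" "x \<noteq> y"
    using in_class_R_card_ge_2[OF R] by (metis card_2_iff' obtain_subset_with_card_n subsetD)
  then obtain a b where ab: "a \<in> M" "b \<in> M" "a \<noteq> b"
    and min: "\<And>u v. u \<in> M \<Longrightarrow> v \<in> M \<Longrightarrow> u \<noteq> v \<Longrightarrow> d a b \<le> d u v"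
    using obtain_closest_pair[OF fin] by metis
  \<comment> \<open>With \<open>S\<close> the whole space, the condition on points outside
    \<open>S\<close> is vacuous.\<close>
  have g: "restrict (Transposition.transpose a b) M \<in> isometries M d"
    using ab min by (intro closest_pair_swap[of M]) auto
  have "inj_on (d a) M"
  proof (rule ccontr)
    assume "\<not> inj_on (d a) M"
    then obtain p q where pq: "p \<in> M" "q \<in> M" "p \<noteq> q" "d a p = d a q"
      by (auto simp: inj_on_def)
    define S where "S = {z \<in> M. d a z = d a p}"
    have "finite S" "p \<in> S" "q \<in> S" using fin pq by (auto simp: S_def)
    then obtain z w where zw: "z \<in> S" "w \<in> S" "z \<noteq> w"
      and minS: "\<And>u v. u \<in> S \<Longrightarrow> v \<in> S \<Longrightarrow> u \<noteq> v \<Longrightarrow> d z w \<le> d u v"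
      using obtain_closest_pair pq(3) by metis
    \<comment> \<open>A point \<open>u\<close> inside the sphere has the radius as its distance to
      both \<open>z\<close> and \<open>w\<close>; for \<open>u\<close> beyond the sphere both
      distances equal \<open>d a u\<close>.\<close>
    have "d u z = d u w" if "u \<in> M - S" for u
    proof (cases "d a u < d a p")
      case True
      then have "d u z = d a z" "d u w = d a w"
        using isosceles[of a u] that zw ab by (auto simp: S_def)
      then show ?thesis using zw by (simp add: S_def)
    next
      case False
      then have "d a p < d a u" using that by (auto simp: S_def)
      then have "d z u = d a u" "d w u = d a u"
        using isosceles[of a _ u] that zw ab by (auto simp: S_def)
      then show ?thesis by (simp add: commute)
    qed
    then have h: "restrict (Transposition.transpose z w) M \<in> isometries M d"
      using zw minS by (intro closest_pair_swap[of S]) (auto simp: S_def)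
    have zwM: "z \<in> M" "w \<in> M" using zw by (auto simp: S_def)
    \<comment> \<open>Radius 0 would force \<open>p = a = q\<close>.\<close>
    have "d a p \<noteq> 0"
      using pq ab by (metis zero)
    then have "a \<notin> S" using ab by (simp add: S_def)
    then have ne: "z \<noteq> a" "w \<noteq> a" using zw by auto
    let ?k = "compose M (restrict (Transposition.transpose a b) M) (restrict (Transposition.transpose z w) M)"
    have "?k \<in> isometries M d"
      using g h by (rule isometries_compose)
    then have "card M \<le> card (fixed_points M ?k) + 2"
      using R by (rule in_class_R_le_card_fixed_points[rotated])
    \<comment> \<open>The point \<open>b\<close> may be \<open>z\<close> or \<open>w\<close>; then
      \<open>?k\<close> is a 3-cycle on \<open>a\<close>, \<open>z\<close>, \<open>w\<close>.
      Otherwise the two swaps are disjoint. Either way all three points move.\<close>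
    moreover have "?k v \<noteq> v" if "v \<in> {a, z, w}" for v
      using that ab zw(3) zwM ne by (auto simp: compose_def Transposition.transpose_def)
    then have "card (fixed_points M ?k) + card {a, z, w} \<le> card M"
      using fin ab zwM by (intro card_fixed_points_le) auto
    ultimately show False
      using zw(3) ne by auto
  qed
  moreover have "d a ` M \<subseteq> spectrum M d"
    using ab by (auto simp: spectrum_def)
  ultimately show ?thesis
    by (metis card_image card_mono fin finite_spectrum)
qed

end

theorem corollary3p5:
  fixes X :: "'a set" and dX :: "'a \<Rightarrow> 'a \<Rightarrow> real"
    and Y :: "'b set" and dY :: "'b \<Rightarrow> 'b \<Rightarrow> real"
  assumes "finite X" and "Ultrametric_space X dX"
    and "finite Y" and "Ultrametric_space Y dY"
    and "card X = card Y"
    and "in_class_R Y dY"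
  shows "card (spectrum X dX) \<le> card (spectrum Y dY)"
proof -
  have "card (spectrum X dX) \<le> card X"
    using Ultrametric_space.card_spectrum_le[OF assms(2) assms(1) order_refl] .
  also have "\<dots> \<le> card (spectrum Y dY)"
    using Ultrametric_space.in_class_R_card_le_spectrum[OF assms(4,6)] assms(5) by simp
  finally show ?thesis .
qed

end
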